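(* Let $X$ be a strongly hyperbolic space (with parameters $\delta$ and $b$), let $x_0,\dots,x_n$ be a sequence of points in $X$ and let $\rho,\sigma>0$ be constants such that G) $d(x_{i-1},x_i)\ge\rho$ for $i=1,\dots,n$; A) $\langle x_{i-1},x_{i+1}\rangle_{x_i}\le\sigma$ for $i=1,\dots,n-1$; P) $2\sigma<\rho-2\delta$. Then 1) $\langle x_0,x_n\rangle_{x_{n-1}}<\sigma+\frac{1}{\log b}\,b^{2\sigma-\rho+2\delta}$; 2) $d(x_0,x_n)>\rho+(n-1)(\rho-2\sigma-2\delta)$; 3) $\displaystyle\Big|d(x_0,x_n)+\sum_{i=2}^{n-1}d(x_{i-1},x_i)-\sum_{i=1}^{n-1}d(x_{i-1},x_{i+1})\Big|\le 2(n-1)\frac{1}{\log b}\,b^{2\sigma-\rho+2\delta}.$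
   Context: For a metric space $(X,d)$ put $\langle x,z\rangle_y=\frac12(d(x,y)+d(y,z)-d(x,z))$. $X$ is $\delta$-hyperbolic ($\delta>0$) if $\langle x,z\rangle_w\ge\min\{\langle x,y\rangle_w,\langle y,z\rangle_w\}-\delta$ for all $x,y,z,w\in X$. Fix a basepoint $o\in X$. A sequence $(x_n)$ is a Gromov sequence if $\langle x_n,x_m\rangle_{o}\to\infty$ as $n,m\to\infty$; two Gromov sequences are equivalent if $\langle x_n,y_n\rangle_{o}\to\infty$; the Gromov boundary $\partial X$ is the set of equivalence classes, and $\mathrm{Bord}\,X=X\cup\partial X$. The Gromov product is extended to $\mathrm{Bord}\,X$ by $\langle\xi,\eta\rangle_z=\inf\liminf_{n,m\to\infty}\langle x_n,y_m\rangle_z$, the infimum being over sequences $(x_n)\in\xi$, $(y_m)\in\eta$ (constant sequences being used for points of $X$). Let $X$ be $\delta$-hyperbolic, fix $1<b\le2^{1/\delta}$ and set $\rho_{x,b}(\xi,\eta)=b^{-\langle\xi,\eta\rangle_x}$ on $\mathrm{Bord}\,X$. $X$ is strongly hyperbolic if for every $x\in X$ the map $\rho_{x,b}$ satisfies the triangle inequality on $\mathrm{Bord}\,X$. $\log$ is the natural logarithm.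
   Formalization: The number of steps is taken to be n ≥ 2; for n = 1 the statement fails, since two points at distance exactly ρ violate conclusion 2), and conclusion 3) with empty sums would give d(x_0,x_1) ≤ 0. *)

theory Defs
  imports "HOL-Analysis.Analysis"
begin

definition gromov_product :: "'a::metric_space \<Rightarrow> 'a \<Rightarrow> 'a \<Rightarrow> real" where
  "gromov_product y x z = (dist x y + dist y z - dist x z) / 2"

definition gromov_hyperbolic :: "'a::metric_space itself \<Rightarrow> real \<Rightarrow> bool" where
  "gromov_hyperbolic _ \<delta> \<longleftrightarrow> \<delta> > 0 \<and>
     (\<forall>x y z w :: 'a. gromov_product w x z
        \<ge> min (gromov_product w x y) (gromov_product w y z) - \<delta>)"

text \<open>The argument \<open>p\<close> below is the basepoint used to define the boundary.\<close>

definition gromov_sequence :: "'a::metric_space \<Rightarrow> (nat \<Rightarrow> 'a) \<Rightarrow> bool" where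
  "gromov_sequence p u \<longleftrightarrow>
     filterlim (\<lambda>(n, m). gromov_product p (u n) (u m)) at_top (sequentially \<times>\<^sub>F sequentially)"

definition gromov_rel :: "'a::metric_space \<Rightarrow> ((nat \<Rightarrow> 'a) \<times> (nat \<Rightarrow> 'a)) set" where
  "gromov_rel p = {(u, v). gromov_sequence p u \<and> gromov_sequence p v \<and>
     filterlim (\<lambda>n. gromov_product p (u n) (v n)) at_top sequentially}"

definition gromov_boundary :: "'a::metric_space \<Rightarrow> (nat \<Rightarrow> 'a) set set" where
  "gromov_boundary p = {u. gromov_sequence p u} // gromov_rel p"

definition Bord :: "'a::metric_space \<Rightarrow> ('a + (nat \<Rightarrow> 'a) set) set" where
  "Bord p = UNIV <+> gromov_boundary p"

text \<open>The sequences over which the infimum in the extended product is taken.\<close>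

fun representatives :: "'a + (nat \<Rightarrow> 'a) set \<Rightarrow> (nat \<Rightarrow> 'a) set" where
  "representatives (Inl x) = {\<lambda>_. x}"
| "representatives (Inr C) = C"

definition ext_gromov_product ::
  "'a::metric_space \<Rightarrow> 'a + (nat \<Rightarrow> 'a) set \<Rightarrow> 'a + (nat \<Rightarrow> 'a) set \<Rightarrow> ereal" where
  "ext_gromov_product z \<xi> \<eta> =
     (INF u\<in>representatives \<xi>. INF v\<in>representatives \<eta>.
        Liminf (sequentially \<times>\<^sub>F sequentially) (\<lambda>(n, m). ereal (gromov_product z (u n) (v m))))"

text \<open>The extended product may be \<open>\<infinity>\<close>, where \<open>b\<^sup>-\<^sup>\<infinity> = 0\<close>; it is never \<open>-\<infinity>\<close>, being nonnegative
  (see \<open>ext_gromov_product_nonneg\<close> below).\<close>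

definition visual_dist ::
  "'a::metric_space \<Rightarrow> real \<Rightarrow> 'a + (nat \<Rightarrow> 'a) set \<Rightarrow> 'a + (nat \<Rightarrow> 'a) set \<Rightarrow> real" where
  "visual_dist x b \<xi> \<eta> =
     (if ext_gromov_product x \<xi> \<eta> = \<infinity> then 0
      else b powr (- real_of_ereal (ext_gromov_product x \<xi> \<eta>)))"

definition strongly_hyperbolic :: "'a::metric_space \<Rightarrow> real \<Rightarrow> real \<Rightarrow> bool" where
  "strongly_hyperbolic p \<delta> b \<longleftrightarrow>
     gromov_hyperbolic TYPE('a) \<delta> \<and> 1 < b \<and> b \<le> 2 powr (1 / \<delta>) \<and>
     (\<forall>x. \<forall>\<xi>\<in>Bord p. \<forall>\<eta>\<in>Bord p. \<forall>\<zeta>\<in>Bord p.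
        visual_dist x b \<xi> \<zeta> \<le> visual_dist x b \<xi> \<eta> + visual_dist x b \<eta> \<zeta>)"

lemma gromov_product_nonneg: "0 \<le> gromov_product y x z"
  unfolding gromov_product_def using dist_triangle[of x z y] by simp

lemma gromov_product_commute: "gromov_product y x z = gromov_product y z x"
  unfolding gromov_product_def by (simp add: dist_commute)

lemma ext_gromov_product_nonneg: "0 \<le> ext_gromov_product z \<xi> \<eta>"
  unfolding ext_gromov_product_def
  by (intro INF_greatest Liminf_bounded always_eventually)
     (auto simp: gromov_product_nonneg)

lemma ext_gromov_product_points:
  "ext_gromov_product z (Inl x) (Inl y) = ereal (gromov_product z x y)"
  by (simp add: ext_gromov_product_def Liminf_const prod_filter_eq_bot case_prod_unfold)

lemma equiv_gromov_rel:
  fixes p :: "'a::metric_space"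
  assumes "gromov_hyperbolic TYPE('a) \<delta>"
  shows "equiv {u. gromov_sequence p u} (gromov_rel p)"
proof (rule equivI)
  show "gromov_rel p \<subseteq> {u. gromov_sequence p u} \<times> {u. gromov_sequence p u}"
    by (auto simp: gromov_rel_def)
  show "refl_on {u. gromov_sequence p u} (gromov_rel p)"
  proof (rule refl_onI)
    fix u assume "u \<in> {u. gromov_sequence p u}"
    then have u: "gromov_sequence p u" by simp
    have "filterlim (\<lambda>n. (n, n)) (sequentially \<times>\<^sub>F sequentially) sequentially"
      by (intro filterlim_Pair filterlim_ident)
    from filterlim_compose[OF u[unfolded gromov_sequence_def] this]
    show "(u, u) \<in> gromov_rel p" using u by (simp add: gromov_rel_def)
  qed
  show "sym (gromov_rel p)"
    by (auto simp: sym_def gromov_rel_def gromov_product_commute)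
  show "trans (gromov_rel p)"
  proof (rule transI)
    fix u v w assume uv: "(u, v) \<in> gromov_rel p" and vw: "(v, w) \<in> gromov_rel p"
    have hyp: "min (gromov_product p (u n) (v n)) (gromov_product p (v n) (w n)) - \<delta>
        \<le> gromov_product p (u n) (w n)" for n
      using assms unfolding gromov_hyperbolic_def by blast
    have "filterlim (\<lambda>n. gromov_product p (u n) (w n)) at_top sequentially"
      unfolding filterlim_at_top
    proof
      fix Z
      have "\<forall>\<^sub>F n in sequentially. Z + \<delta> \<le> gromov_product p (u n) (v n)"
        and "\<forall>\<^sub>F n in sequentially. Z + \<delta> \<le> gromov_product p (v n) (w n)"
        using uv vw by (auto simp: gromov_rel_def filterlim_at_top)
      then show "\<forall>\<^sub>F n in sequentially. Z \<le> gromov_product p (u n) (w n)"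
      proof eventually_elim
        case (elim n)
        then show ?case using hyp[of n] by linarith
      qed
    qed
    then show "(u, w) \<in> gromov_rel p" using uv vw by (simp add: gromov_rel_def)
  qed
qed

end

theory Submission
  imports Defs
begin

text \<open>Write \<open>S\<^sub>i\<close> and \<open>T\<^sub>i\<close> for the Gromov products at \<open>x\<^sub>i\<close> of \<open>x\<^sub>i\<^sub>+\<^sub>1\<close> with \<open>x\<^sub>i\<^sub>-\<^sub>1\<close> and with \<open>x\<^sub>0\<close>.
  Hyperbolicity propagates \<open>T\<^sub>i \<le> \<sigma> + \<delta>\<close> along the chain, so the product of \<open>x\<^sub>0\<close> and \<open>x\<^sub>i\<^sub>-\<^sub>1\<close> at
  \<open>x\<^sub>i\<close> is large, and the triangle inequality for the visual metric at \<open>x\<^sub>i\<close> then makes \<open>T\<^sub>i\<close> and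
  \<open>S\<^sub>i\<close> nearly equal. The quantity inside the absolute value in (3) changes by exactly
  \<open>2 (S\<^sub>i - T\<^sub>i)\<close> when the chain is extended by one point. When \<open>b powr \<delta>\<close> is close to 1 the visual
  metric alone does not give the stated constant, and one has to combine it with
  \<open>T\<^sub>i \<le> S\<^sub>i + \<delta>\<close>.\<close>

lemma dist_eq_gromov_product:
  "dist x z = dist x y + dist y z - 2 * gromov_product y x z"
  by (simp add: gromov_product_def field_simps)

lemma gromov_product_add: "gromov_product z x y + gromov_product y x z = dist y z"
  by (simp add: gromov_product_def dist_commute field_simps)

lemma strongly_hyperbolic_powr_triangle:
  fixes p x y z w :: "'a::metric_space"
  assumes "strongly_hyperbolic p \<delta> b"
  shows "b powr (- gromov_product w x z)
    \<le> b powr (- gromov_product w x y) + b powr (- gromov_product w y z)"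
proof -
  have "\<forall>w. \<forall>\<xi>\<in>Bord p. \<forall>\<eta>\<in>Bord p. \<forall>\<zeta>\<in>Bord p.
      visual_dist w b \<xi> \<zeta> \<le> visual_dist w b \<xi> \<eta> + visual_dist w b \<eta> \<zeta>"
    using assms by (simp add: strongly_hyperbolic_def)
  moreover have "Inl q \<in> Bord p" for q :: 'a
    by (auto simp: Bord_def)
  ultimately have "visual_dist w b (Inl x) (Inl z)
      \<le> visual_dist w b (Inl x) (Inl y) + visual_dist w b (Inl y) (Inl z)"
    by blast
  then show ?thesis
    by (simp add: visual_dist_def ext_gromov_product_points)
qed

text \<open>The exponential inequality alone need not give \<open>t < u\<close> when
  \<open>d\<close> is small; the bound \<open>t \<le> d\<close> closes the gap. If
  \<open>t \<ge> u\<close>, then \<open>u \<le> d\<close>, and multiplying by \<open>exp d\<close>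
  gives \<open>exp (d - u) * (exp u - 1) \<le> u\<close>, against
  \<open>exp u - 1 > u\<close>.\<close>

lemma less_of_exp_minus_ge:
  fixes t d u :: real
  assumes "t \<le> d" and "1 - u * exp (- d) \<le> exp (- t)" and "u > 0"
  shows "t < u"
proof (rule ccontr)
  assume "\<not> t < u"
  then have ud: "u \<le> d" and "exp (- t) \<le> exp (- u)"
    using assms(1) by auto
  then have "1 - u * exp (- d) \<le> exp (- u)"
    using assms(2) by linarith
  then have "exp d * (1 - u * exp (- d)) \<le> exp d * exp (- u)"
    by (rule mult_left_mono) simp
  then have "exp d - u \<le> exp (d - u)"
    by (simp add: algebra_simps exp_minus exp_diff divide_inverse)
  moreover have "exp d = exp (d - u) * exp u"
    by (simp flip: exp_add)
  moreover have "u < 1 * (exp u - 1)"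
    using exp_minus_greater[of "- u"] \<open>u > 0\<close> by simp
  moreover have "1 * (exp u - 1) \<le> exp (d - u) * (exp u - 1)"
    using ud \<open>u > 0\<close> by (intro mult_right_mono) auto
  ultimately show False
    by (simp add: algebra_simps)
qed

text \<open>Seen from \<open>w\<close>, the points \<open>o'\<close> and \<open>y\<close> lie in
  nearly the same direction, so either may stand in for the other. Along the chain, \<open>y\<close>
  and \<open>z\<close> are the neighbours of \<open>w\<close>, and \<open>o'\<close> is
  \<open>x 0\<close>.\<close>

lemma gromov_product_change_point:
  fixes p o' w y z :: "'a::metric_space"
  assumes sh: "strongly_hyperbolic p \<delta> b"
    and S: "gromov_product w y z \<le> \<sigma>"
    and a: "gromov_product w o' y \<ge> \<rho> - \<sigma> - \<delta>"
    and P: "2 * \<sigma> < \<rho> - 2 * \<delta>"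
  shows "gromov_product w o' z \<le> gromov_product w y z + \<delta>"
    and "\<bar>gromov_product w o' z - gromov_product w y z\<bar>
           < 1 / ln b * b powr (2 * \<sigma> - \<rho> + 2 * \<delta>)"
proof -
  define S T a where "S = gromov_product w y z" and "T = gromov_product w o' z"
    and "a = gromov_product w o' y"
  define u where "u = b powr (2 * \<sigma> - \<rho> + 2 * \<delta>)"
  have \<delta>: "\<delta> > 0" and b: "b > 1"
    using sh by (auto simp: strongly_hyperbolic_def gromov_hyperbolic_def)
  have hyp: "S \<ge> min a T - \<delta>"
    using sh unfolding strongly_hyperbolic_def gromov_hyperbolic_def S_def T_def a_def
    by (metis gromov_product_commute)
  have le: "S \<le> \<sigma>" "\<rho> - \<sigma> - \<delta> \<le> a"
    using S a by (simp_all add: S_def a_def)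
  \<comment> \<open>By \<open>P\<close>, \<open>a \<ge> \<rho> - \<sigma> - \<delta> > \<sigma> +
    \<delta> \<ge> S + \<delta>\<close>, so the minimum in \<open>hyp\<close> cannot be
    \<open>a\<close>.\<close>
  show T_le: "T \<le> S + \<delta>"
    using hyp le P by (simp add: min_def split: if_splits)
  have u: "u > 0" and lnb: "ln b > 0"
    using b by (simp_all add: u_def)
  have powr_exp: "b powr c = exp (c * ln b)" for c
    using b by (simp add: powr_def)
  \<comment> \<open>The exponent in \<open>u\<close> exceeds the bound on \<open>S - a\<close> by
    one \<delta>. The spare factor \<open>b powr (- \<delta>)\<close> is what
    \<open>less_of_exp_minus_ge\<close> needs with \<open>d = \<delta> * ln b\<close>, and it makes
    \<open>lower\<close> strict.\<close>
  have s: "b powr (S - a) \<le> u * exp (- (\<delta> * ln b))"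
  proof -
    have "b powr (S - a) \<le> b powr (2 * \<sigma> - \<rho> + 2 * \<delta> - \<delta>)"
      using le b by (intro powr_mono) auto
    also have "\<dots> = u * exp (- (\<delta> * ln b))"
      by (simp add: u_def powr_exp flip: exp_add) (simp add: algebra_simps)
    finally show ?thesis .
  qed
  have tri: "b powr (- S) \<le> b powr (- a) + b powr (- T)" "b powr (- T) \<le> b powr (- a) + b powr (- S)"
    using strongly_hyperbolic_powr_triangle[OF sh, of w y z o']
      strongly_hyperbolic_powr_triangle[OF sh, of w o' z y]
    by (simp_all add: S_def T_def a_def gromov_product_commute)
  have scaled: "1 \<le> b powr (S - a) + b powr (S - T)" "b powr (S - T) \<le> b powr (S - a) + 1"
    using tri[THEN mult_left_mono, of "b powr S"] b
    by (simp_all add: distrib_left flip: powr_add)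
  have upper: "(T - S) * ln b < u"
  proof (rule less_of_exp_minus_ge)
    show "(T - S) * ln b \<le> \<delta> * ln b"
      using T_le lnb by (intro mult_right_mono) auto
    show "1 - u * exp (- (\<delta> * ln b)) \<le> exp (- ((T - S) * ln b))"
      using scaled(1) s by (simp add: powr_exp algebra_simps)
  qed (fact u)
  have lower: "(S - T) * ln b < u"
  proof -
    have "1 + (S - T) * ln b \<le> b powr (S - T)"
      unfolding powr_exp by (rule exp_ge_add_one_self)
    also have "\<dots> \<le> 1 + u * exp (- (\<delta> * ln b))"
      using scaled(2) s by simp
    also have "\<dots> < 1 + u"
      using u \<delta> lnb by simp
    finally show ?thesis by simp
  qed
  from upper lower lnb show "\<bar>T - S\<bar> < 1 / ln b * u"
    by (simp add: abs_less_iff field_simps)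
qed

text \<open>The two bounds feed each other: the products at the two ends of an edge add up to its
  length, so the first bound at \<open>x i\<close> gives the second at \<open>x (Suc i)\<close>, and
  changing the point there gives the first again. Errors do not accumulate, since each step restarts
  from the local bound \<open>A\<close>.\<close>

lemma gromov_product_chain_le:
  fixes p :: "'a::metric_space" and x :: "nat \<Rightarrow> 'a"
  assumes sh: "strongly_hyperbolic p \<delta> b" and "\<sigma> \<ge> 0"
    and G: "\<forall>i\<in>{1..n}. dist (x (i - 1)) (x i) \<ge> \<rho>"
    and A: "\<forall>i\<in>{1..n - 1}. gromov_product (x i) (x (i - 1)) (x (i + 1)) \<le> \<sigma>"
    and P: "2 * \<sigma> < \<rho> - 2 * \<delta>"
  shows "i < n \<Longrightarrow> gromov_product (x i) (x 0) (x (Suc i)) \<le> \<sigma> + \<delta>"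
    and "Suc i < n \<Longrightarrow> gromov_product (x (Suc i)) (x 0) (x i) \<ge> \<rho> - \<sigma> - \<delta>"
proof -
  have dist_ge: "dist (x i) (x (Suc i)) \<ge> \<rho>" if "i < n" for i
    using G[rule_format, of "Suc i"] that by simp
  have step: "gromov_product (x (Suc i)) (x 0) (x i) \<ge> \<rho> - \<sigma> - \<delta>"
    if "Suc i < n" "gromov_product (x i) (x 0) (x (Suc i)) \<le> \<sigma> + \<delta>" for i
    using gromov_product_add[of "x (Suc i)" "x 0" "x i"] dist_ge[of i] that by simp
  show bound: "gromov_product (x i) (x 0) (x (Suc i)) \<le> \<sigma> + \<delta>" if "i < n" for i
    using that
  proof (induction i)
    case 0
    show ?case
      using sh \<open>\<sigma> \<ge> 0\<close>
      by (simp add: gromov_product_def strongly_hyperbolic_def gromov_hyperbolic_def)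
  next
    case (Suc i)
    have "gromov_product (x (Suc i)) (x i) (x (Suc (Suc i))) \<le> \<sigma>"
      using A[rule_format, of "Suc i"] Suc.prems by simp
    with gromov_product_change_point(1)[OF sh this step P] Suc show ?case
      by simp
  qed
  show "gromov_product (x (Suc i)) (x 0) (x i) \<ge> \<rho> - \<sigma> - \<delta>" if "Suc i < n"
    using step bound that by simp
qed

theorem theorem3:
  fixes p :: "'a::metric_space" and x :: "nat \<Rightarrow> 'a" and n :: nat and \<delta> b \<rho> \<sigma> :: real
  assumes "strongly_hyperbolic p \<delta> b"
    and "n \<ge> 2" and "\<rho> > 0" and "\<sigma> > 0"
    and G: "\<forall>i\<in>{1..n}. dist (x (i - 1)) (x i) \<ge> \<rho>"
    and A: "\<forall>i\<in>{1..n - 1}. gromov_product (x i) (x (i - 1)) (x (i + 1)) \<le> \<sigma>"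
    and P: "2 * \<sigma> < \<rho> - 2 * \<delta>"
  shows "gromov_product (x (n - 1)) (x 0) (x n)
           < \<sigma> + 1 / ln b * b powr (2 * \<sigma> - \<rho> + 2 * \<delta>)
       \<and> dist (x 0) (x n) > \<rho> + (real n - 1) * (\<rho> - 2 * \<sigma> - 2 * \<delta>)
       \<and> \<bar>dist (x 0) (x n) + (\<Sum>i=2..n - 1. dist (x (i - 1)) (x i))
            - (\<Sum>i=1..n - 1. dist (x (i - 1)) (x (i + 1)))\<bar>
           \<le> 2 * (real n - 1) * (1 / ln b) * b powr (2 * \<sigma> - \<rho> + 2 * \<delta>)"
proof -
  define \<epsilon> where "\<epsilon> = 1 / ln b * b powr (2 * \<sigma> - \<rho> + 2 * \<delta>)"
  \<comment> \<open>\<open>S i\<close> is \<open>S\<^sub>i\<^sub>+\<^sub>1\<close> of the introduction, which avoids truncated subtraction.\<close>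
  define S T where "S i = gromov_product (x (Suc i)) (x i) (x (Suc (Suc i)))"
    and "T i = gromov_product (x i) (x 0) (x (Suc i))" for i
  define E where "E m = dist (x 0) (x m) + (\<Sum>i=2..m - 1. dist (x (i - 1)) (x i))
    - (\<Sum>i=1..m - 1. dist (x (i - 1)) (x (i + 1)))" for m
  have \<delta>: "\<delta> > 0" and b: "b > 1"
    using assms(1) by (auto simp: strongly_hyperbolic_def gromov_hyperbolic_def)
  have \<epsilon>: "\<epsilon> > 0"
    using b by (simp add: \<epsilon>_def)
  have \<sigma>: "\<sigma> \<ge> 0"
    using \<open>\<sigma> > 0\<close> by simp
  note chain = gromov_product_chain_le[OF assms(1) \<sigma> G A P]
  have S: "S i \<le> \<sigma>" if "Suc i < n" for i
    using A[rule_format, of "Suc i"] that by (simp add: S_def)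
  have close: "\<bar>T (Suc i) - S i\<bar> < \<epsilon>" if "Suc i < n" for i
    using gromov_product_change_point(2)[OF assms(1) _ chain(2) P] S that
    unfolding S_def T_def \<epsilon>_def by blast
  have dist_ge: "dist (x i) (x (Suc i)) \<ge> \<rho>" if "i < n" for i
    using G[rule_format, of "Suc i"] that by simp
  obtain k where k: "n = Suc (Suc k)"
    using \<open>n \<ge> 2\<close> by (metis Suc_le_D numeral_2_eq_2 Suc_le_mono)

  have concl1: "gromov_product (x (n - 1)) (x 0) (x n) < \<sigma> + \<epsilon>"
    using close[of k] S[of k] by (simp add: k T_def)

  have dist_Suc: "dist (x 0) (x (Suc i)) = dist (x 0) (x i) + dist (x i) (x (Suc i)) - 2 * T i" for i
    unfolding T_def by (rule dist_eq_gromov_product)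
  have concl2: "dist (x 0) (x (Suc (Suc m))) > \<rho> + real (Suc m) * (\<rho> - 2 * \<sigma> - 2 * \<delta>)"
    if "Suc m < n" for m
    using that
  proof (induction m)
    case 0
    \<comment> \<open>\<open>T 1\<close> is the local product \<open>S 0\<close>, so no \<delta> is
      lost here. This saving makes the inequality strict; later steps only preserve it.\<close>
    have "T 1 \<le> \<sigma>"
      using S[of 0] 0 by (simp add: S_def T_def)
    then show ?case
      using dist_Suc[of 1] dist_ge[of 0] dist_ge[of 1] 0 \<delta> by simp
  next
    case (Suc m)
    have "T (Suc (Suc m)) \<le> \<sigma> + \<delta>"
      unfolding T_def using chain(1)[of "Suc (Suc m)"] Suc.prems by simp
    then show ?case
      using dist_Suc[of "Suc (Suc m)"] dist_ge[of "Suc (Suc m)"] Suc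
      by (simp add: algebra_simps)
  qed

  have E_Suc: "E (Suc (Suc (Suc m))) = E (Suc (Suc m)) + 2 * (S (Suc m) - T (Suc (Suc m)))" for m
    using dist_Suc[of "Suc (Suc m)"]
      dist_eq_gromov_product[of "x (Suc m)" "x (Suc (Suc (Suc m)))" "x (Suc (Suc m))"]
    by (simp add: E_def S_def)
  have concl3: "\<bar>E (Suc (Suc m))\<bar> \<le> 2 * real m * \<epsilon>" if "Suc m < n" for m
    using that
  proof (induction m)
    case 0
    \<comment> \<open>For three points the first sum is empty and the second is
      \<open>dist (x 0) (x 2)\<close>, so \<open>E 2 = 0\<close>. Hence only \<open>n - 2\<close>
      extensions contribute an error.\<close>
    show ?case by (simp add: E_def)
  next
    case (Suc m)
    show ?case
      using Suc close[of "Suc m"] by (simp add: E_Suc algebra_simps)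
  qed
  have "\<bar>E n\<bar> \<le> 2 * real k * \<epsilon>"
    using concl3[of k] by (simp add: k)
  also have "\<dots> \<le> 2 * (real n - 1) * \<epsilon>"
    using \<epsilon> by (simp add: k)
  finally have "\<bar>E n\<bar> \<le> 2 * (real n - 1) * \<epsilon>" .
  then show ?thesis
    using concl1 concl2[of k] by (simp add: E_def \<epsilon>_def k mult.assoc)
qed

end
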